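(* Let $M14_{1}$ be the real Lie algebra with basis $x_1,\dots,x_6$ and nonzero brackets $[x_1,x_3]=x_4$, $[x_1,x_4]=x_6$, $[x_2,x_3]=x_5$, $[x_2,x_5]=x_6$. For $\epsilon\in\{1,-1\}$ let $$J(\epsilon)=\begin{pmatrix}0&-1&0&0&0&0\\1&0&0&0&0&0\\0&0&0&0&0&\epsilon\\0&0&0&0&-1&0\\0&0&0&1&0&0\\0&0&-\frac1\epsilon&0&0&0\end{pmatrix}.$$ Then every complex structure on $M14_1$ is equivalent to $J(1)$ or to $J(-1)$, and $J(1)$, $J(-1)$ are not equivalent; thus the set $\mathfrak{X}_{M14_1}$ of all complex structures on $M14_1$ consists of exactly two $\mathrm{Aut}(M14_1)$-orbits. Moreover $\mathfrak{X}_{M14_1}$ is a submanifold of dimension 8 of $\mathbb{R}^{36}$.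
   Context: Brackets of basis vectors not listed (and not obtained by antisymmetry) are zero. A complex structure on a real Lie algebra $\mathfrak{g}$ is a linear map $J:\mathfrak{g}\to\mathfrak{g}$ with $J^2=-1$ and $[JX,JY]-[X,Y]-J[JX,Y]-J[X,JY]=0$ for all $X,Y\in\mathfrak{g}$. $J$ is identified with its $6\times 6$ matrix $(\xi^k_j)$ ($k$ the row index, $j$ the column index) in the basis $(x_j)$, i.e. $Jx_j=\sum_k\xi^k_j x_k$; so the set of complex structures is a subset of $\mathbb{R}^{36}$. "Submanifold" means smooth ($C^\infty$) submanifold. $\mathrm{Aut}(\mathfrak{g})$ acts on complex structures by $J\mapsto\Phi^{-1}J\Phi$, and two complex structures are equivalent if they lie in the same orbit. *)

theory Defs
  imports "HOL-Analysis.Analysis"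
begin

section \<open>Smooth submanifolds of a Euclidean space\<close>

primrec Ck_on :: "nat \<Rightarrow> 'a::euclidean_space set \<Rightarrow> ('a \<Rightarrow> 'b::euclidean_space) \<Rightarrow> bool" where
  "Ck_on 0 U f \<longleftrightarrow> continuous_on U f"
| "Ck_on (Suc k) U f \<longleftrightarrow> (\<forall>x\<in>U. f differentiable (at x)) \<and>
     (\<forall>v. Ck_on k U (\<lambda>x. frechet_derivative f (at x) v))"

text \<open>Only meant for open \<open>U\<close>.\<close>

definition smooth_on :: "'a::euclidean_space set \<Rightarrow> ('a \<Rightarrow> 'b::euclidean_space) \<Rightarrow> bool" where
  "smooth_on U f \<longleftrightarrow> (\<forall>k. Ck_on k U f)"

definition diffeomorphism ::
  "'a::euclidean_space set \<Rightarrow> 'b::euclidean_space set \<Rightarrow> ('a \<Rightarrow> 'b) \<Rightarrow> ('b \<Rightarrow> 'a) \<Rightarrow> bool" where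
  "diffeomorphism U V \<phi> \<psi> \<longleftrightarrow>
     open U \<and> open V \<and> homeomorphism U V \<phi> \<psi> \<and> smooth_on U \<phi> \<and> smooth_on V \<psi>"

text \<open>Embedded submanifolds, by slice charts: near each of its points, \<open>S\<close> is straightened to an
  open piece of a \<open>d\<close>-dimensional linear subspace by a diffeomorphism of the ambient space.\<close>

definition smooth_submanifold :: "nat \<Rightarrow> 'a::euclidean_space set \<Rightarrow> bool" where
  "smooth_submanifold d S \<longleftrightarrow>
     (\<forall>p\<in>S. \<exists>(U::'a set) (V::'a set) \<phi> \<psi> T. p \<in> U \<and> diffeomorphism U V \<phi> \<psi> \<and>
        subspace T \<and> dim T = d \<and> \<phi> ` (U \<inter> S) = V \<inter> T)"


section \<open>Complex structures on a Lie algebra with underlying space \<open>real ^ 'n\<close>\<close>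

text \<open>The type \<open>real ^ 'n ^ 'n\<close> serves both as the space of linear endomorphisms, given by their
  matrices (\<open>A $ k $ j\<close> is the entry in row \<open>k\<close> and column \<open>j\<close>), and as the Euclidean space of
  dimension \<open>n\<^sup>2\<close> containing the set of complex structures.\<close>

definition complex_structures ::
  "(real ^ 'n \<Rightarrow> real ^ 'n \<Rightarrow> real ^ 'n) \<Rightarrow> (real ^ 'n ^ 'n) set" where
  "complex_structures br = {J. J ** J = - mat 1 \<and>
     (\<forall>X Y. br (J *v X) (J *v Y) - br X Y - J *v br (J *v X) Y - J *v br X (J *v Y) = 0)}"

definition lie_automorphisms ::
  "(real ^ 'n \<Rightarrow> real ^ 'n \<Rightarrow> real ^ 'n) \<Rightarrow> (real ^ 'n ^ 'n) set" where
  "lie_automorphisms br =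
     {\<Phi>. invertible \<Phi> \<and> (\<forall>X Y. \<Phi> *v br X Y = br (\<Phi> *v X) (\<Phi> *v Y))}"

definition aut_orbit ::
  "(real ^ 'n \<Rightarrow> real ^ 'n \<Rightarrow> real ^ 'n) \<Rightarrow> real ^ 'n ^ 'n \<Rightarrow> (real ^ 'n ^ 'n) set" where
  "aut_orbit br J = {matrix_inv \<Phi> ** J ** \<Phi> | \<Phi>. \<Phi> \<in> lie_automorphisms br}"

definition aut_equivalent ::
  "(real ^ 'n \<Rightarrow> real ^ 'n \<Rightarrow> real ^ 'n) \<Rightarrow> real ^ 'n ^ 'n \<Rightarrow> real ^ 'n ^ 'n \<Rightarrow> bool" where
  "aut_equivalent br J K \<longleftrightarrow> (\<exists>\<Phi>\<in>lie_automorphisms br. K = matrix_inv \<Phi> ** J ** \<Phi>)"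


section \<open>The Lie algebra \<open>M14\<^sub>1\<close>\<close>

abbreviation x_basis :: "6 \<Rightarrow> real ^ 6" where
  "x_basis j \<equiv> axis j 1"

text \<open>In the index type \<open>6\<close> the sixth index is \<open>6 = 0\<close>.\<close>

definition M14_table :: "6 \<Rightarrow> 6 \<Rightarrow> real ^ 6" where
  "M14_table i j =
     (if (i, j) = (1, 3) then x_basis 4
      else if (i, j) = (1, 4) then x_basis 6
      else if (i, j) = (2, 3) then x_basis 5
      else if (i, j) = (2, 5) then x_basis 6
      else 0)"

definition M14_bracket :: "real ^ 6 \<Rightarrow> real ^ 6 \<Rightarrow> real ^ 6" where
  "M14_bracket X Y =
     (\<Sum>i\<in>UNIV. \<Sum>j\<in>UNIV. (X $ i * Y $ j) *\<^sub>R (M14_table i j - M14_table j i))"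

definition M14_J :: "real \<Rightarrow> real ^ 6 ^ 6" where
  "M14_J \<epsilon> = vector [
     vector [0, -1,    0, 0,  0, 0],
     vector [1,  0,    0, 0,  0, 0],
     vector [0,  0,    0, 0,  0, \<epsilon>],
     vector [0,  0,    0, 0, -1, 0],
     vector [0,  0,    0, 1,  0, 0],
     vector [0,  0, -1/\<epsilon>, 0,  0, 0]]"

lemma UNIV_6: "(UNIV :: 6 set) = {1, 2, 3, 4, 5, 6}"
proof (rule sym, rule card_seteq)
  show "card (UNIV :: 6 set) \<le> card {1, 2, 3, 4, 5, 6 :: 6}" by simp
qed auto

lemma sum_6: "sum f (UNIV :: 6 set) = f 1 + f 2 + f 3 + f 4 + f 5 + f 6"
  unfolding UNIV_6 by (simp add: ac_simps)

lemma forall_6: "(\<forall>i::6. P i) \<longleftrightarrow> P 1 \<and> P 2 \<and> P 3 \<and> P 4 \<and> P 5 \<and> P 6"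
proof -
  have "(\<forall>i::6. P i) \<longleftrightarrow> (\<forall>i\<in>UNIV. P i)" by simp
  also have "\<dots> \<longleftrightarrow> P 1 \<and> P 2 \<and> P 3 \<and> P 4 \<and> P 5 \<and> P 6"
    unfolding UNIV_6 by (simp only: ball_simps simp_thms)
  finally show ?thesis .
qed

lemma vector_6:
  "(vector [a, b, c, d, e, f] :: 'a::zero ^ 6) $ 1 = a"
  "(vector [a, b, c, d, e, f] :: 'a::zero ^ 6) $ 2 = b"
  "(vector [a, b, c, d, e, f] :: 'a::zero ^ 6) $ 3 = c"
  "(vector [a, b, c, d, e, f] :: 'a::zero ^ 6) $ 4 = d"
  "(vector [a, b, c, d, e, f] :: 'a::zero ^ 6) $ 5 = e"
  "(vector [a, b, c, d, e, f] :: 'a::zero ^ 6) $ 6 = f"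
  by (simp_all add: vector_def)

lemma M14_table_nth:
  "M14_table i j $ 1 = 0"
  "M14_table i j $ 2 = 0"
  "M14_table i j $ 3 = 0"
  "M14_table i j $ 4 = of_bool (i = 1) * of_bool (j = 3)"
  "M14_table i j $ 5 = of_bool (i = 2) * of_bool (j = 3)"
  "M14_table i j $ 6 = of_bool (i = 1) * of_bool (j = 4) + of_bool (i = 2) * of_bool (j = 5)"
  by (auto simp: M14_table_def axis_def)

lemma M14_bracket_nth_sum:
  "M14_bracket X Y $ k =
     (\<Sum>i\<in>UNIV. \<Sum>j\<in>UNIV. X $ i * Y $ j * (M14_table i j $ k - M14_table j i $ k))"
  by (simp add: M14_bracket_def)

lemma M14_bracket_nth:
  "M14_bracket X Y $ 1 = 0"
  "M14_bracket X Y $ 2 = 0"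
  "M14_bracket X Y $ 3 = 0"
  "M14_bracket X Y $ 4 = X $ 1 * Y $ 3 - X $ 3 * Y $ 1"
  "M14_bracket X Y $ 5 = X $ 2 * Y $ 3 - X $ 3 * Y $ 2"
  "M14_bracket X Y $ 6 = X $ 1 * Y $ 4 - X $ 4 * Y $ 1 + X $ 2 * Y $ 5 - X $ 5 * Y $ 2"
  by (simp_all add: M14_bracket_nth_sum M14_table_nth sum_6)

lemma bilinear_M14_bracket: "bilinear M14_bracket"
  by (auto simp: bilinear_def vec_eq_iff forall_6 M14_bracket_nth algebra_simps intro!: linearI)

lemma M14_bracket_self: "M14_bracket X X = 0"
  by (simp add: vec_eq_iff forall_6 M14_bracket_nth)

lemma M14_bracket_Jacobi:
  "M14_bracket X (M14_bracket Y Z) + M14_bracket Y (M14_bracket Z X)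
     + M14_bracket Z (M14_bracket X Y) = 0"
  by (simp add: vec_eq_iff forall_6 M14_bracket_nth algebra_simps)

lemma M14_bracket_basis: "M14_bracket (x_basis i) (x_basis j) = M14_table i j - M14_table j i"
proof -
  have "M14_bracket (x_basis i) (x_basis j) =
    (\<Sum>k\<in>UNIV. \<Sum>l\<in>UNIV. if k = i \<and> l = j then M14_table k l - M14_table l k else 0)"
    unfolding M14_bracket_def by (intro sum.cong refl) (auto simp: axis_def)
  also have "\<dots> = (\<Sum>k\<in>UNIV. if k = i then M14_table k j - M14_table j k else 0)"
    by (intro sum.cong refl) simp
  finally show ?thesis by simp
qed

end

(* With Z = J x6, integrability on the pairs (x_i, x6) says that ad Z commutes with J. This forces
   Z = z (x3 + A x4 + B x5 + C x6) with z nonzero, makes J preserve the abelian ideal <x3,...,x6>,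
   and gives J the same 2x2 block on <x1, x2> (modulo that ideal) as on the image of ad Z; the pair
   (x1, x4) then forces this block to be s (0 -1; 1 0) with s = 1 or s = -1. Everything else is
   determined by the two free columns J x1 and J x6 (rows 3 to 6), so the complex structures form two
   disjoint graphs over open subsets of R^8. Conversely, each such J is carried to J(sgn z) by an
   explicit automorphism, which also shows that it is integrable. *)
theory Submission
  imports Defs
begin

section \<open>Calculus of \<open>C\<^sup>k\<close> maps\<close>

text \<open>Openness of \<open>U\<close> makes \<open>f\<close> and \<open>g\<close> agree near each
  point of \<open>U\<close>, so their derivatives agree on \<open>U\<close> and the induction can
  descend to them.\<close>

lemma Ck_on_cong:
  assumes "open U" "\<And>x. x \<in> U \<Longrightarrow> f x = g x" "Ck_on k U f"
  shows "Ck_on k U g"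
  using assms(2,3)
proof (induction k arbitrary: f g)
  case 0
  then show ?case using continuous_on_cong[of U U f g] by simp
next
  case (Suc k)
  have g: "(g has_derivative frechet_derivative f (at x)) (at x)" if "x \<in> U" for x
  proof (rule has_derivative_transform_within_open[OF _ assms(1) that])
    show "(f has_derivative frechet_derivative f (at x)) (at x)"
      using Suc.prems(2) that by (metis Ck_on.simps(2) frechet_derivative_works)
  qed (rule Suc.prems(1))
  show ?case unfolding Ck_on.simps
  proof (intro conjI ballI allI)
    show "g differentiable at x" if "x \<in> U" for x
      using g[OF that] by (rule differentiableI)
    have "frechet_derivative f (at x) v = frechet_derivative g (at x) v" if "x \<in> U" for x v
      using frechet_derivative_at[OF g[OF that]] by (rule fun_cong)
    then show "Ck_on k U (\<lambda>x. frechet_derivative g (at x) v)" for v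
      using conjunct2[OF Suc.prems(2)[unfolded Ck_on.simps]] by - (rule Suc.IH, assumption, erule spec)
  qed
qed

text \<open>Replaces the chosen \<open>frechet_derivative\<close> by any explicit derivative; the
  closure rules below are inductions through this rule.\<close>

lemma Ck_on_SucI:
  assumes "open U" "\<And>x. x \<in> U \<Longrightarrow> (f has_derivative f' x) (at x)"
    and "\<And>v. Ck_on k U (\<lambda>x. f' x v)"
  shows "Ck_on (Suc k) U f"
  unfolding Ck_on.simps
proof (intro conjI ballI allI)
  show "f differentiable at x" if "x \<in> U" for x
    using assms(2)[OF that] by (rule differentiableI)
  have "f' x v = frechet_derivative f (at x) v" if "x \<in> U" for x v
    using frechet_derivative_at[OF assms(2)[OF that]] by (rule fun_cong)
  then show "Ck_on k U (\<lambda>x. frechet_derivative f (at x) v)" for v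
    by (rule Ck_on_cong[OF assms(1) _ assms(3)])
qed

lemma Ck_on_SucD:
  assumes "Ck_on (Suc k) U f"
  shows "x \<in> U \<Longrightarrow> (f has_derivative frechet_derivative f (at x)) (at x)"
    and "Ck_on k U (\<lambda>x. frechet_derivative f (at x) v)"
proof -
  note * = assms[unfolded Ck_on.simps]
  show "(f has_derivative frechet_derivative f (at x)) (at x)" if "x \<in> U"
    using conjunct1[OF *, rule_format, OF that] by (rule frechet_derivative_works[THEN iffD1])
  show "Ck_on k U (\<lambda>x. frechet_derivative f (at x) v)"
    by (rule conjunct2[OF *, rule_format])
qed

lemma Ck_on_Suc_imp: "Ck_on (Suc k) U f \<Longrightarrow> Ck_on k U f"
proof (induction k arbitrary: f)
  case 0
  then show ?case
    by (auto intro!: continuous_at_imp_continuous_on differentiable_imp_continuous_within)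
next
  case (Suc k)
  have "f differentiable at x" if "x \<in> U" for x
    using Ck_on_SucD(1)[OF Suc.prems that] by (rule differentiableI)
  moreover have "Ck_on k U (\<lambda>x. frechet_derivative f (at x) v)" for v
    by (rule Suc.IH[OF Ck_on_SucD(2)[OF Suc.prems]])
  ultimately show ?case by simp
qed

section \<open>Closure of the \<open>C^k\<close> maps under algebraic operations\<close>

lemma Ck_on_const: "Ck_on k U (\<lambda>x. c)"
proof (induction k arbitrary: c)
  case (Suc k)
  have "frechet_derivative (\<lambda>x. c) (at x) = (\<lambda>v. 0)" for x :: 'a
    by (rule frechet_derivative_at[symmetric]) (rule has_derivative_const)
  with Suc show ?case by simp
qed simp

lemma Ck_on_bounded_linear_compose:
  assumes "bounded_linear L" "open U" "Ck_on k U f"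
  shows "Ck_on k U (\<lambda>x. L (f x))"
  using assms(3)
proof (induction k arbitrary: f)
  case 0
  then show ?case using bounded_linear.continuous_on[OF assms(1)] by simp
next
  case (Suc k)
  show ?case
    by (rule Ck_on_SucI[OF assms(2)],
        erule bounded_linear.has_derivative[OF assms(1) Ck_on_SucD(1)[OF Suc.prems]],
        rule Suc.IH[OF Ck_on_SucD(2)[OF Suc.prems]])
qed

lemma Ck_on_id: "open U \<Longrightarrow> Ck_on k U (\<lambda>x. x)"
  by (cases k) (simp, blast intro: Ck_on_SucI[OF _ has_derivative_ident] Ck_on_const)

lemma Ck_on_add:
  assumes "open U" "Ck_on k U f" "Ck_on k U g"
  shows "Ck_on k U (\<lambda>x. f x + g x)"
  using assms(2,3)
proof (induction k arbitrary: f g)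
  case 0
  then show ?case by (auto intro: continuous_intros)
next
  case (Suc k)
  show ?case
    by (rule Ck_on_SucI[OF assms(1)],
        rule has_derivative_add[OF Ck_on_SucD(1)[OF Suc.prems(1)] Ck_on_SucD(1)[OF Suc.prems(2)]],
        assumption, assumption,
        rule Suc.IH[OF Ck_on_SucD(2)[OF Suc.prems(1)] Ck_on_SucD(2)[OF Suc.prems(2)]])
qed

lemma Ck_on_minus: "open U \<Longrightarrow> Ck_on k U f \<Longrightarrow> Ck_on k U (\<lambda>x. - f x)"
  by (rule Ck_on_bounded_linear_compose[OF bounded_linear_minus[OF bounded_linear_ident]])

lemma Ck_on_diff:
  "open U \<Longrightarrow> Ck_on k U f \<Longrightarrow> Ck_on k U g \<Longrightarrow> Ck_on k U (\<lambda>x. f x - g x)"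
  using Ck_on_add[of U k f "\<lambda>x. - g x"] by (simp add: Ck_on_minus)

lemma Ck_on_sum:
  assumes "open U" "\<And>i. i \<in> I \<Longrightarrow> Ck_on k U (f i)"
  shows "Ck_on k U (\<lambda>x. \<Sum>i\<in>I. f i x)"
  using assms(2)
proof (induction I rule: infinite_finite_induct)
  case (insert i I)
  then show ?case by (simp add: Ck_on_add assms(1))
qed (auto intro: Ck_on_const)

lemma Ck_on_mult:
  fixes f g :: "'a::euclidean_space \<Rightarrow> real"
  assumes "open U" "Ck_on k U f" "Ck_on k U g"
  shows "Ck_on k U (\<lambda>x. f x * g x)"
  using assms(2,3)
proof (induction k arbitrary: f g)
  case 0
  then show ?case by (auto intro: continuous_intros)
next
  case (Suc k)
  note fg = Suc.prems[THEN Ck_on_Suc_imp]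
  show ?case
    by (rule Ck_on_SucI[OF assms(1)],
        rule has_derivative_mult[OF Ck_on_SucD(1)[OF Suc.prems(1)] Ck_on_SucD(1)[OF Suc.prems(2)]],
        assumption, assumption,
        rule Ck_on_add[OF assms(1) Suc.IH[OF fg(1) Ck_on_SucD(2)[OF Suc.prems(2)]]
            Suc.IH[OF Ck_on_SucD(2)[OF Suc.prems(1)] fg(2)]])
qed

text \<open>The derivative of 1/f is -(1/f) f' (1/f), so the induction hypothesis for 1/f itself
  supplies the two outer factors.\<close>

lemma Ck_on_inverse:
  fixes f :: "'a::euclidean_space \<Rightarrow> real"
  assumes "open U" "Ck_on k U f" "\<And>x. x \<in> U \<Longrightarrow> f x \<noteq> 0"
  shows "Ck_on k U (\<lambda>x. inverse (f x))"
  using assms(2)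
proof (induction k)
  case 0
  then show ?case using assms(3) by (auto intro: continuous_on_inverse)
next
  case (Suc k)
  have inv: "Ck_on k U (\<lambda>x. inverse (f x))"
    by (rule Suc.IH[OF Ck_on_Suc_imp[OF Suc.prems]])
  show ?case
  proof (rule Ck_on_SucI[OF assms(1)])
    show "((\<lambda>x. inverse (f x)) has_derivative
        (\<lambda>v. - (inverse (f x) * frechet_derivative f (at x) v * inverse (f x)))) (at x)"
      if "x \<in> U" for x
      by (rule Deriv.has_derivative_inverse[OF assms(3)[OF that] Ck_on_SucD(1)[OF Suc.prems that]])
    have "Ck_on k U (\<lambda>x. (- 1) * (inverse (f x) * frechet_derivative f (at x) v * inverse (f x)))"
      for v
      by (intro Ck_on_mult assms(1) Ck_on_const inv Ck_on_SucD(2)[OF Suc.prems])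
    then show "Ck_on k U (\<lambda>x. - (inverse (f x) * frechet_derivative f (at x) v * inverse (f x)))"
      for v
      by simp
  qed
qed

lemma Ck_on_basis:
  assumes "open U" "\<And>b. b \<in> Basis \<Longrightarrow> Ck_on k U (\<lambda>x. f x \<bullet> b)"
  shows "Ck_on k U f"
proof -
  have "Ck_on k U (\<lambda>x. \<Sum>b\<in>Basis. (f x \<bullet> b) *\<^sub>R b)"
    by (intro Ck_on_sum assms Ck_on_bounded_linear_compose[OF bounded_linear_scaleR_left])
  then show ?thesis by (simp add: euclidean_representation)
qed

lemma Ck_on_matrix:
  fixes f :: "'a::euclidean_space \<Rightarrow> real ^ 'n ^ 'm"
  assumes "open U" "\<And>i j. Ck_on k U (\<lambda>x. f x $ i $ j)"
  shows "Ck_on k U f"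
proof (rule Ck_on_basis[OF assms(1)])
  fix b :: "real ^ 'n ^ 'm" assume "b \<in> Basis"
  then obtain i j where "b = axis i (axis j 1)" by (auto simp: Basis_vec_def)
  then show "Ck_on k U (\<lambda>x. f x \<bullet> b)" by (simp add: inner_axis assms(2))
qed

lemma Ck_on_matrix_entry:
  "open U \<Longrightarrow> Ck_on k U (\<lambda>x :: real ^ 'n ^ 'm. x $ i $ j)"
  by (rule Ck_on_bounded_linear_compose[where f = "\<lambda>x. x"])
     (simp_all add: Ck_on_id bounded_linear_compose[OF bounded_linear_vec_nth bounded_linear_vec_nth])

text \<open>If \<open>G\<close> is invariant under subtracting its own values, the shear \<open>x \<mapsto> x - G x\<close> is inverted by
  \<open>x \<mapsto> x + G x\<close>; this is how a graph over \<open>T\<close> gets straightened.\<close>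

lemma shear_diffeomorphism:
  fixes G :: "'a::euclidean_space \<Rightarrow> 'a"
  assumes U: "open U" and V: "open V" and G: "smooth_on U G" "smooth_on V G"
    and UV: "\<And>x. x \<in> U \<Longrightarrow> x - G x \<in> V" "\<And>y. y \<in> V \<Longrightarrow> y + G y \<in> U"
    and inv: "\<And>x. G (x - G x) = G x" "\<And>y. G (y + G y) = G y"
  shows "diffeomorphism U V (\<lambda>x. x - G x) (\<lambda>y. y + G y)"
proof -
  have "Ck_on k U (\<lambda>x. x + (- 1) *\<^sub>R G x)" for k
    using G(1) U unfolding smooth_on_def
    by (intro Ck_on_add Ck_on_id Ck_on_bounded_linear_compose[OF bounded_linear_scaleR_right]) auto
  then have \<phi>: "smooth_on U (\<lambda>x. x - G x)" by (simp add: smooth_on_def)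
  have \<psi>: "smooth_on V (\<lambda>y. y + G y)"
    using G(2) V unfolding smooth_on_def by (auto intro!: Ck_on_add Ck_on_id)
  have "homeomorphism U V (\<lambda>x. x - G x) (\<lambda>y. y + G y)"
  proof (rule homeomorphismI)
    show "continuous_on U (\<lambda>x. x - G x)" "continuous_on V (\<lambda>y. y + G y)"
      using \<phi> \<psi> by (simp_all add: smooth_on_def flip: Ck_on.simps(1))
    show "(\<lambda>x. x - G x) ` U \<subseteq> V" "(\<lambda>y. y + G y) ` V \<subseteq> U"
      using UV by blast+
    show "x - G x + G (x - G x) = x" for x
      by (simp only: inv diff_add_cancel)
    show "y + G y - G (y + G y) = y" for y
      by (simp only: inv add_diff_cancel)
  qed
  with U V \<phi> \<psi> show ?thesis unfolding diffeomorphism_def by blast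
qed

section \<open>Equivalence under automorphisms\<close>

text \<open>The intertwining form avoids \<open>matrix_inv\<close>, so equivalences can be checked
  entry by entry.\<close>

lemma aut_equivalent_iff:
  "aut_equivalent br J K \<longleftrightarrow> (\<exists>\<Phi>\<in>lie_automorphisms br. J ** \<Phi> = \<Phi> ** K)"
  unfolding aut_equivalent_def
proof (rule bex_cong[OF refl])
  fix \<Phi> assume "\<Phi> \<in> lie_automorphisms br"
  then have "invertible \<Phi>" by (simp add: lie_automorphisms_def)
  then have inv: "\<Phi> ** matrix_inv \<Phi> = mat 1 \<and> matrix_inv \<Phi> ** \<Phi> = mat 1"
    unfolding invertible_def matrix_inv_def by (rule someI_ex)
  show "K = matrix_inv \<Phi> ** J ** \<Phi> \<longleftrightarrow> J ** \<Phi> = \<Phi> ** K"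
    by (metis inv matrix_mul_assoc matrix_mul_lid)
qed

lemma aut_orbit_eq: "aut_orbit br J = {K. aut_equivalent br J K}"
  by (auto simp: aut_orbit_def aut_equivalent_def)

section \<open>Symmetry and transitivity of equivalence, and transport of complex structures\<close>

lemma lie_automorphisms_mult:
  assumes "\<Phi> \<in> lie_automorphisms br" "\<Psi> \<in> lie_automorphisms br"
  shows "\<Phi> ** \<Psi> \<in> lie_automorphisms br"
  using assms
  by (auto simp: lie_automorphisms_def invertible_mult simp flip: matrix_vector_mul_assoc)

lemma lie_automorphisms_inverse:
  assumes "\<Phi> \<in> lie_automorphisms br" "\<Phi> ** \<Psi> = mat 1" "\<Psi> ** \<Phi> = mat 1"
  shows "\<Psi> \<in> lie_automorphisms br"
proof -
  have "\<Psi> *v br X Y = br (\<Psi> *v X) (\<Psi> *v Y)" for X Y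
  proof -
    have "br (\<Psi> *v X) (\<Psi> *v Y) = \<Psi> *v (\<Phi> *v br (\<Psi> *v X) (\<Psi> *v Y))"
      by (simp add: matrix_vector_mul_assoc assms(3))
    also have "\<dots> = \<Psi> *v br (\<Phi> *v (\<Psi> *v X)) (\<Phi> *v (\<Psi> *v Y))"
      using assms(1) by (simp add: lie_automorphisms_def)
    also have "\<dots> = \<Psi> *v br X Y"
      by (simp add: matrix_vector_mul_assoc assms(2))
    finally show ?thesis by simp
  qed
  with assms(2,3) show ?thesis
    by (auto simp: lie_automorphisms_def invertible_def)
qed

lemma aut_equivalent_sym:
  assumes "aut_equivalent br J K"
  shows "aut_equivalent br K J"
proof -
  obtain \<Phi> where \<Phi>: "\<Phi> \<in> lie_automorphisms br" "J ** \<Phi> = \<Phi> ** K"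
    using assms by (auto simp: aut_equivalent_iff)
  then obtain \<Psi> where \<Psi>: "\<Phi> ** \<Psi> = mat 1" "\<Psi> ** \<Phi> = mat 1"
    by (auto simp: lie_automorphisms_def invertible_def)
  have "K ** \<Psi> = \<Psi> ** J"
    by (metis \<Phi>(2) \<Psi> matrix_mul_assoc matrix_mul_lid matrix_mul_rid)
  with lie_automorphisms_inverse[OF \<Phi>(1) \<Psi>] show ?thesis
    by (auto simp: aut_equivalent_iff)
qed

lemma aut_equivalent_trans:
  assumes "aut_equivalent br J K" "aut_equivalent br K L"
  shows "aut_equivalent br J L"
proof -
  obtain \<Phi> \<Psi> where "\<Phi> \<in> lie_automorphisms br" "J ** \<Phi> = \<Phi> ** K"
    and "\<Psi> \<in> lie_automorphisms br" "K ** \<Psi> = \<Psi> ** L"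
    using assms by (auto simp: aut_equivalent_iff)
  then have "\<Phi> ** \<Psi> \<in> lie_automorphisms br" "J ** (\<Phi> ** \<Psi>) = (\<Phi> ** \<Psi>) ** L"
    by (simp_all add: lie_automorphisms_mult) (metis matrix_mul_assoc)
  then show ?thesis by (auto simp: aut_equivalent_iff)
qed

lemma aut_orbit_cong: "aut_equivalent br J K \<Longrightarrow> aut_orbit br J = aut_orbit br K"
  by (auto simp: aut_orbit_eq intro: aut_equivalent_trans aut_equivalent_sym)

text \<open>Since \<Phi> respects the bracket and intertwines \<open>K\<close> with
  \<open>J\<close>, it maps each defining expression of \<open>K\<close> to that of \<open>J\<close>
  at the image vectors; injectivity of \<Phi> then pulls the identities back.\<close>

lemma aut_equivalent_complex_structure:
  fixes br :: "real ^ 'n \<Rightarrow> real ^ 'n \<Rightarrow> real ^ 'n"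
  assumes "aut_equivalent br J K" "J \<in> complex_structures br"
  shows "K \<in> complex_structures br"
proof -
  obtain \<Phi> where \<Phi>: "\<Phi> \<in> lie_automorphisms br" "J ** \<Phi> = \<Phi> ** K"
    using assms by (auto simp: aut_equivalent_iff)
  then obtain \<Psi> where \<Psi>: "\<Phi> ** \<Psi> = mat 1" "\<Psi> ** \<Phi> = mat 1"
    by (auto simp: lie_automorphisms_def invertible_def)
  have J2: "J ** J = - mat 1"
    and N: "br (J *v X) (J *v Y) - br X Y - J *v br (J *v X) Y - J *v br X (J *v Y) = 0" for X Y
    using assms(2) by (auto simp: complex_structures_def)
  have br: "\<Phi> *v br X Y = br (\<Phi> *v X) (\<Phi> *v Y)" for X Y
    using \<Phi>(1) by (simp add: lie_automorphisms_def)
  have JK: "\<Phi> *v (K *v X) = J *v (\<Phi> *v X)" for X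
    by (simp add: matrix_vector_mul_assoc \<Phi>(2))
  have inj: "X = Y" if "\<Phi> *v X = \<Phi> *v Y" for X Y
    by (metis \<Psi>(2) matrix_vector_mul_assoc matrix_vector_mul_lid that)
  have "(- M) *v X = - (M *v X)" "M *v (- X) = - (M *v X)" for M :: "real ^ 'n ^ 'n" and X
    by (simp_all add: vec_eq_iff matrix_vector_mult_def sum_negf)
  then have minus: "(- mat 1 :: real ^ 'n ^ 'n) *v X = - X" "\<Phi> *v (- X) = - (\<Phi> *v X)" for X
    by simp_all
  have "K *v (K *v X) = - X" for X
  proof (rule inj)
    have "\<Phi> *v (K *v (K *v X)) = J *v (J *v (\<Phi> *v X))"
      by (simp only: JK)
    also have "\<dots> = \<Phi> *v (- X)"
      by (simp only: matrix_vector_mul_assoc[of J J] J2 minus)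
    finally show "\<Phi> *v (K *v (K *v X)) = \<Phi> *v (- X)" .
  qed
  then have "K ** K = - mat 1"
    by (simp only: matrix_eq matrix_vector_mul_assoc[symmetric] minus simp_thms)
  moreover have
    "br (K *v X) (K *v Y) - br X Y - K *v br (K *v X) Y - K *v br X (K *v Y) = 0" for X Y
    by (rule inj)
      (simp only: matrix_vector_mult_diff_distrib matrix_vector_mult_0_right br JK N)
  ultimately show ?thesis unfolding complex_structures_def by blast
qed

section \<open>Complex structures on \<open>M14\<^sub>1\<close>\<close>

text \<open>The free entries are those of the columns \<open>J x\<^sub>1\<close> and \<open>J x\<^sub>6\<close> in rows 3 to 6, the latter column
  being \<open>z (1, A, B, C)\<close>, with \<open>w = 1 / z\<close>. The matrix below holds the entries that they determine,
  and zeros in the free positions.\<close>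

definition M14_dependent ::
  "real \<Rightarrow> real \<Rightarrow> real \<Rightarrow> real \<Rightarrow> real \<Rightarrow> real \<Rightarrow> real \<Rightarrow> real \<Rightarrow> real \<Rightarrow> real \<Rightarrow> real ^ 6 ^ 6" where
  "M14_dependent s z w A B C v3 v4 v5 v6 = vector [
     vector [0, - s, 0, 0, 0, 0],
     vector [s, 0, 0, 0, 0, 0],
     vector [0, - s * (v3 * (z * (A * A + B * B - C)) - v4 * (z * A) - v5 * (z * B) + v6 * z),
       z * (A * A + B * B - C), - (z * A), - (z * B), 0],
     vector [0, - s * (v3 * (A * (z * (A * A + B * B - C)) + s * B) - v4 * (z * A * A)
         + v5 * (- s - z * A * B) + v6 * (z * A)),
       A * (z * (A * A + B * B - C)) + s * B, - (z * A * A), - s - z * A * B, 0],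
     vector [0, - s * (v3 * (B * (z * (A * A + B * B - C)) - s * A) + v4 * (s - z * A * B)
         - v5 * (z * B * B) + v6 * (z * B)),
       B * (z * (A * A + B * B - C)) - s * A, s - z * A * B, - (z * B * B), 0],
     vector [0, - s * (v3 * (C * (z * (A * A + B * B - C)) - w) + v4 * (s * B - z * A * C)
         + v5 * (- s * A - z * B * C) + v6 * (z * C)),
       C * (z * (A * A + B * B - C)) - w, s * B - z * A * C, - s * A - z * B * C, 0]]"

text \<open>A map on the whole matrix space that reads only the free entries and vanishes there.
  Subtracting its value therefore does not change it, as \<open>shear_diffeomorphism\<close>
  requires, and a matrix lies on the graph when the difference is in
  \<open>M14_free\<close>.\<close>

definition M14_graph :: "real \<Rightarrow> real ^ 6 ^ 6 \<Rightarrow> real ^ 6 ^ 6" where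
  "M14_graph s J = (let w = inverse (J $ 3 $ 6) in
     M14_dependent s (J $ 3 $ 6) w (J $ 4 $ 6 * w) (J $ 5 $ 6 * w) (J $ 6 $ 6 * w)
       (J $ 3 $ 1) (J $ 4 $ 1) (J $ 5 $ 1) (J $ 6 $ 1))"

definition M14_free :: "(real ^ 6 ^ 6) set" where
  "M14_free = {K. \<forall>i j. i \<in> {3, 4, 5, 6} \<and> j \<in> {1, 6} \<or> K $ i $ j = 0}"

lemma axis_component: "axis i x $ j = (if j = i then x else 0)"
  by (simp add: axis_def)

lemma matrix_vector_mul_basis_nth: "(J *v x_basis j) $ k = (J :: real ^ 6 ^ 6) $ k $ j"
  by (simp add: matrix_vector_mul_component inner_axis)

text \<open>The columns are solved in the order 6, 4, 5, 3, 2: integrability with x6 gives columns 4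
  and 5, and J^2 = -1 gives columns 3 and 2.\<close>

lemma M14_complex_structure_normal_form:
  fixes J :: "real ^ 6 ^ 6"
  assumes "J \<in> complex_structures M14_bracket"
  shows "J $ 3 $ 6 \<noteq> 0" "\<exists>s\<in>{1, - 1}. J - M14_graph s J \<in> M14_free"
proof -
  have "J ** J = - mat 1" using assms by (simp add: complex_structures_def)
  then have sq: "(\<Sum>j\<in>UNIV. J $ i $ j * J $ j $ k) = (if i = k then - 1 else 0)" for i k
    by (simp add: vec_eq_iff matrix_matrix_mult_def mat_def)
  note sq = sq[unfolded sum_6]
  have "(M14_bracket (J *v X) (J *v Y) - M14_bracket X Y - J *v M14_bracket (J *v X) Y
      - J *v M14_bracket X (J *v Y)) $ k = 0" for X Y k
    using assms by (simp add: complex_structures_def)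
  then have N: "M14_bracket (J *v X) (J *v Y) $ k - M14_bracket X Y $ k
      - (\<Sum>i\<in>UNIV. J $ k $ i * M14_bracket (J *v X) Y $ i)
      - (\<Sum>i\<in>UNIV. J $ k $ i * M14_bracket X (J *v Y) $ i) = 0" for X Y k
    by (simp add: matrix_vector_mult_def)
  note N = N[unfolded sum_6 M14_bracket_nth matrix_vector_mul_basis_nth]
  note Nb = M14_bracket_nth matrix_vector_mul_basis_nth axis_component
  \<comment> \<open>As x6 is central and [x4, J x6] is a multiple of x6, row 1 of the integrability
    equation says that the square of this entry vanishes.\<close>
  have z1: "J $ 1 $ 6 = 0"
    using N[of "x_basis 4" "x_basis 6" 1] by (simp add: Nb)
  have z2: "J $ 2 $ 6 = 0"
    using N[of "x_basis 5" "x_basis 6" 2] by (simp add: Nb)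
  note z12 = z1 z2
  \<comment> \<open>Now J x6 lies in the abelian ideal, so [xj, J x6] = 0 and integrability leaves
    [J xj, J x6] = 0; these are its rows 4 and 5.\<close>
  have *: "J $ 1 $ j * J $ 3 $ 6 = 0" "J $ 2 $ j * J $ 3 $ 6 = 0" if "j \<in> {3, 4, 5}" for j
    using that N[of "x_basis j" "x_basis 6" 4] N[of "x_basis j" "x_basis 6" 5]
    by (auto simp: Nb z12)
  have z3: "J $ 3 $ 6 \<noteq> 0"
  proof
    \<comment> \<open>Then the squares of the entries (4,6) and (5,6) vanish as well, so x6 would be
      a real eigenvector of J.\<close>
    assume z3: "J $ 3 $ 6 = 0"
    have "J $ 4 $ 6 = 0" using N[of "x_basis 1" "x_basis 6" 4] by (simp add: Nb z12 z3)
    moreover have "J $ 5 $ 6 = 0" using N[of "x_basis 2" "x_basis 6" 5] by (simp add: Nb z12 z3)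
    ultimately have "J $ 6 $ 6 * J $ 6 $ 6 = - 1" using sq[of 6 6] by (simp add: z12 z3)
    then show False by (metis zero_le_square neg_0_le_iff_le not_one_le_zero)
  qed
  then show "J $ 3 $ 6 \<noteq> 0" .
  have blk: "J $ 1 $ 3 = 0" "J $ 2 $ 3 = 0" "J $ 1 $ 4 = 0" "J $ 2 $ 4 = 0" "J $ 1 $ 5 = 0"
    "J $ 2 $ 5 = 0"
    using * z3 by auto
  define z where "z = J $ 3 $ 6"
  define A where "A = J $ 4 $ 6 * inverse z"
  define B where "B = J $ 5 $ 6 * inverse z"
  define C where "C = J $ 6 $ 6 * inverse z"
  have z: "z \<noteq> 0" using z3 by (simp add: z_def)
  have c6: "J $ 3 $ 6 = z" "J $ 4 $ 6 = z * A" "J $ 5 $ 6 = z * B" "J $ 6 $ 6 = z * C"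
    using z by (simp_all add: z_def[symmetric] A_def B_def C_def)
  note simps = z12 blk c6
  \<comment> \<open>The four rows of J [x1, J x6] = [J x1, J x6], where [x1, J x6] = z (x4 + A
    x6).\<close>
  have c4: "z * J $ 3 $ 4 = - (z * A * z)" "z * J $ 4 $ 4 = z * J $ 1 $ 1 - z * A * (z * A)"
    "z * J $ 5 $ 4 = z * J $ 2 $ 1 - z * A * (z * B)"
    "z * J $ 6 $ 4 = z * A * J $ 1 $ 1 + z * B * J $ 2 $ 1 - z * A * (z * C)"
    using N[of "x_basis 1" "x_basis 6" 3] N[of "x_basis 1" "x_basis 6" 4]
      N[of "x_basis 1" "x_basis 6" 5] N[of "x_basis 1" "x_basis 6" 6]
    by (simp_all add: Nb simps algebra_simps)
  have c4: "J $ 3 $ 4 = - (z * A)" "J $ 4 $ 4 = J $ 1 $ 1 - z * A * A"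
    "J $ 5 $ 4 = J $ 2 $ 1 - z * A * B"
    "J $ 6 $ 4 = A * J $ 1 $ 1 + B * J $ 2 $ 1 - z * A * C"
    by (rule mult_left_cancel[THEN iffD1, OF z], simp add: c4 algebra_simps)+
  have "2 * (z * J $ 1 $ 1) = 0"
    using N[of "x_basis 1" "x_basis 4" 3] by (simp add: Nb simps c4 algebra_simps)
  then have J11: "J $ 1 $ 1 = 0" using z by simp
  define s where "s = J $ 2 $ 1"
  \<comment> \<open>In row 6 of the pair (x1, x4) all terms with A, B, C cancel, leaving s^2 - 1 =
    0.\<close>
  have ss: "s * s = 1"
    using N[of "x_basis 1" "x_basis 4" 6]
    by (simp add: Nb simps c4 J11 s_def algebra_simps)
  then have s: "s \<in> {1, - 1}" by (simp add: square_eq_1_iff)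
  have J12: "J $ 1 $ 2 = - s" "J $ 2 $ 2 = 0"
    using sq[of 1 1] sq[of 2 1] s by (auto simp: simps J11 s_def)
  \<comment> \<open>As for column 4, with x2 in place of x1: [x2, J x6] = z (x5 + B x6).\<close>
  have c5: "z * J $ 3 $ 5 = - (z * B * z)" "z * J $ 4 $ 5 = - z * s - z * B * (z * A)"
    "z * J $ 5 $ 5 = - z * B * (z * B)"
    "z * J $ 6 $ 5 = - z * A * s - z * B * (z * C)"
    subgoal using N[of "x_basis 2" "x_basis 6" 3] by (simp add: Nb simps J12 algebra_simps)
    subgoal using N[of "x_basis 2" "x_basis 6" 4] by (simp add: Nb simps J12 algebra_simps)
    subgoal using N[of "x_basis 2" "x_basis 6" 5] by (simp add: Nb simps J12 algebra_simps)
    subgoal using N[of "x_basis 2" "x_basis 6" 6] by (simp add: Nb simps J12 algebra_simps)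
    done
  have c5: "J $ 3 $ 5 = - (z * B)" "J $ 4 $ 5 = - s - z * A * B"
    "J $ 5 $ 5 = - z * B * B" "J $ 6 $ 5 = - s * A - z * B * C"
    by (rule mult_left_cancel[THEN iffD1, OF z], simp add: c5 algebra_simps)+
  have c4: "J $ 3 $ 4 = - (z * A)" "J $ 4 $ 4 = - z * A * A"
    "J $ 5 $ 4 = s - z * A * B" "J $ 6 $ 4 = s * B - z * A * C"
    by (simp_all add: c4 J11 s_def)
  \<comment> \<open>This will be the entry (3,3). Column 3 results from solving J (J x6) = -x6 for J
    x3.\<close>
  define m where "m = z * (A * A + B * B - C)"
  have c3: "z * J $ 3 $ 3 = z * m" "z * J $ 4 $ 3 = z * (A * m + s * B)"
    "z * J $ 5 $ 3 = z * (B * m - s * A)" "z * J $ 6 $ 3 = z * (C * m - inverse z)"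
    using sq[of 3 6] sq[of 4 6] sq[of 5 6] sq[of 6 6] z
    by (simp_all add: simps c4 c5 m_def algebra_simps)
  have c3: "J $ 3 $ 3 = m" "J $ 4 $ 3 = A * m + s * B" "J $ 5 $ 3 = B * m - s * A"
    "J $ 6 $ 3 = C * m - inverse z"
    using c3 z by (simp_all only: mult_left_cancel[OF z])
  \<comment> \<open>Write J x1 = s x2 + v. Then J^2 x1 = -x1 and s^2 = 1 give J x2 = -s (x1 + J v);
    the term x1 is why row 1 is excluded.\<close>
  have c2: "J $ k $ 2 = - s * (J $ 3 $ 1 * J $ k $ 3 + J $ 4 $ 1 * J $ k $ 4
      + J $ 5 $ 1 * J $ k $ 5 + J $ 6 $ 1 * J $ k $ 6)" if "k \<noteq> 1" for k
  proof -
    have "J $ k $ 2 * s + (J $ 3 $ 1 * J $ k $ 3 + J $ 4 $ 1 * J $ k $ 4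
      + J $ 5 $ 1 * J $ k $ 5 + J $ 6 $ 1 * J $ k $ 6) = 0" (is "_ + ?v = 0")
      using sq[of k 1] that by (simp add: J11 s_def mult.commute add.assoc)
    then have "J $ k $ 2 * s = - ?v" by (simp add: add_eq_0_iff2)
    moreover have "J $ k $ 2 = J $ k $ 2 * s * s" by (simp only: mult.assoc ss mult_1_right)
    ultimately show ?thesis by (simp only: minus_mult_commute mult.commute[of _ s])
  qed
  have "J - M14_graph s J \<in> M14_free"
    unfolding M14_free_def M14_graph_def Let_def mem_Collect_eq forall_6
      z_def[symmetric] A_def[symmetric] B_def[symmetric] C_def[symmetric]
      M14_dependent_def vector_minus_component vector_6 m_def[symmetric]
    by (simp add: simps J11 J12 c2 c3 c4 c5 s_def[symmetric])
  with s show "\<exists>s\<in>{1, - 1}. J - M14_graph s J \<in> M14_free" by blast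
qed

text \<open>A basis with the same bracket table is built in which J has the matrix
  \<open>M14_J\<close>. The sign s is absorbed into the second basis vector, so only the sign of the
  entry (3,6) survives.\<close>

lemma M14_normal_form_equivalent:
  fixes J :: "real ^ 6 ^ 6"
  assumes J36: "J $ 3 $ 6 \<noteq> 0" and s: "s \<in> {1, - 1}" and J: "J - M14_graph s J \<in> M14_free"
  shows "aut_equivalent M14_bracket J (M14_J (sgn (J $ 3 $ 6)))"
proof -
  define z where "z = J $ 3 $ 6"
  define w where "w = inverse z"
  define \<epsilon> where "\<epsilon> = sgn z"
  \<comment> \<open>With x1 scaled by \<alpha>, the sixth basis vector is \<alpha>^2 x6. It must go
    under J to \<epsilon> times the third, which is J x6 / z, so \<alpha>^2 z = \<epsilon>.\<close>
  define \<alpha> where "\<alpha> = sqrt \<bar>w\<bar>"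
  define A where "A = J $ 4 $ 6 * w"
  define B where "B = J $ 5 $ 6 * w"
  define C where "C = J $ 6 $ 6 * w"
  \<comment> \<open>These are coordinates of J x1 in an adapted basis: with Z = J x6 and y = Z / z,
    J x1 = s x2 + p Z + r [x1, y] + t [x2, y] + q x6.\<close>
  define p where "p = J $ 3 $ 1 * w"
  define r where "r = J $ 4 $ 1 - J $ 3 $ 1 * A"
  define t where "t = J $ 5 $ 1 - J $ 3 $ 1 * B"
  define q where "q = J $ 6 $ 1 - J $ 3 $ 1 * C - r * A - t * B"
  have zw: "z * w = 1" and \<epsilon>: "\<epsilon> \<in> {1, - 1}" and \<alpha>: "\<alpha> * \<alpha> = \<epsilon> * w" "\<alpha> \<noteq> 0"
    using J36 by (auto simp: z_def w_def \<epsilon>_def \<alpha>_def sgn_if)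
  have free: "J $ 3 $ 6 = z" "J $ 4 $ 6 = z * A" "J $ 5 $ 6 = z * B" "J $ 6 $ 6 = z * C"
    "J $ 3 $ 1 = p * z" "J $ 4 $ 1 = r + p * z * A" "J $ 5 $ 1 = t + p * z * B"
    "J $ 6 $ 1 = q + p * z * C + r * A + t * B"
    using zw zw[unfolded mult.commute[of z]] by (auto simp: z_def[symmetric] A_def B_def C_def p_def r_def t_def q_def)
  have zA: "z * x * w = x" for x using zw by (simp add: ac_simps)
  have "\<forall>i j. i \<in> {3, 4, 5, 6} \<and> j \<in> {1, 6} \<or> J $ i $ j = M14_graph s J $ i $ j"
    using J unfolding M14_free_def by simp
  then have "\<forall>i j. i \<in> {3, 4, 5, 6} \<and> j \<in> {1, 6} \<or> J $ i $ j =
      M14_dependent s z w A B C (p * z) (r + p * z * A) (t + p * z * B) (q + p * z * C + r * A + t * B) $ i $ j"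
    by (simp only: M14_graph_def Let_def free zA simp_thms flip: w_def)
  note dep = this[unfolded M14_dependent_def forall_6 vector_6, simplified]
  have inv_\<epsilon>: "- 1 / \<epsilon> = - \<epsilon>" and wz: "w * z = 1"
    using \<epsilon> zw by (auto simp: mult.commute[of w])
  have \<alpha>\<alpha>: "\<alpha> * (\<alpha> * x) = \<epsilon> * w * x" for x by (simp only: mult.assoc[symmetric] \<alpha>(1))
  have rel: "\<alpha> * (\<alpha> * z) = \<epsilon>" "\<alpha> * (\<alpha> * \<epsilon>) = w"
    unfolding \<alpha>\<alpha> using \<epsilon> by (auto simp: mult.assoc wz)
  \<comment> \<open>The columns are \<open>y\<^sub>1\<close>, \<open>y\<^sub>2 = J y\<^sub>1\<close>, \<open>y\<^sub>3 = J x\<^sub>6 / z\<close>, \<open>y\<^sub>4 = [y\<^sub>1, y\<^sub>3]\<close>, \<open>y\<^sub>5 = [y\<^sub>2, y\<^sub>3]\<close>,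
    \<open>y\<^sub>6 = [y\<^sub>1, y\<^sub>4]\<close>, where \<open>y\<^sub>1\<close> corrects \<open>\<alpha> x\<^sub>1\<close> so that \<open>[y\<^sub>1, y\<^sub>2] = 0\<close>.\<close>
  define \<Phi> :: "real ^ 6 ^ 6" where "\<Phi> = vector [
     vector [\<alpha>, 0, 0, 0, 0, 0],
     vector [0, s * \<alpha>, 0, 0, 0, 0],
     vector [0, 0, 1, 0, 0, 0],
     vector [0, \<alpha> * r / 2, A, \<alpha>, 0, 0],
     vector [\<alpha> * s * r / 2, \<alpha> * t, B, 0, s * \<alpha>, 0],
     vector [\<alpha> * (s * r * B / 2 - p), \<alpha> * (q + r * A / 2 + t * B), C, \<alpha> * A, s * \<alpha> * B, \<alpha> * \<alpha>]]"
  have "J ** \<Phi> = \<Phi> ** M14_J \<epsilon>"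
    unfolding vec_eq_iff forall_6 matrix_matrix_mult_def vec_lambda_beta sum_6 \<Phi>_def M14_J_def vector_6
    by (simp only: dep free inv_\<epsilon>) (use s in \<open>elim insertE emptyE; simp add: rel wz field_simps\<close>)
  moreover have "\<Phi> \<in> lie_automorphisms M14_bracket"
  proof -
    have "X = 0" if "\<Phi> *v X = 0" for X
      using that s \<alpha>(2)
      by (auto simp: vec_eq_iff forall_6 matrix_vector_mult_def sum_6 \<Phi>_def vector_6)
    then have "invertible \<Phi>"
      by (simp add: invertible_left_inverse matrix_left_invertible_ker)
    moreover have "\<Phi> *v M14_bracket X Y = M14_bracket (\<Phi> *v X) (\<Phi> *v Y)" for X Y
      using s by (auto simp: vec_eq_iff forall_6 matrix_vector_mult_def sum_6 \<Phi>_def vector_6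
          M14_bracket_nth field_simps)
    ultimately show ?thesis by (simp add: lie_automorphisms_def)
  qed
  ultimately show ?thesis
    unfolding aut_equivalent_iff \<epsilon>_def z_def by blast
qed

section \<open>The two orbits\<close>

lemma M14_J_complex_structure:
  assumes "\<epsilon> \<in> {1, - 1}"
  shows "M14_J \<epsilon> \<in> complex_structures M14_bracket"
proof -
  have "M14_J \<epsilon> ** M14_J \<epsilon> = - mat 1"
    unfolding vec_eq_iff forall_6 matrix_matrix_mult_def vec_lambda_beta sum_6 M14_J_def vector_6
    using assms by (auto simp: mat_def)
  moreover have "M14_bracket (M14_J \<epsilon> *v X) (M14_J \<epsilon> *v Y) - M14_bracket X Y
      - M14_J \<epsilon> *v M14_bracket (M14_J \<epsilon> *v X) Y - M14_J \<epsilon> *v M14_bracket X (M14_J \<epsilon> *v Y) = 0"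
    for X Y
    unfolding vec_eq_iff forall_6 vector_minus_component M14_bracket_nth matrix_vector_mult_def
      vec_lambda_beta sum_6 M14_J_def vector_6
    using assms by (auto simp: M14_bracket_nth algebra_simps)
  ultimately show ?thesis by (simp add: complex_structures_def)
qed

text \<open>From right to left, integrability is transported from J(1) or J(-1) along the
  equivalence.\<close>

lemma M14_complex_structure_iff:
  "J \<in> complex_structures M14_bracket \<longleftrightarrow>
    J $ 3 $ 6 \<noteq> 0 \<and> (\<exists>s\<in>{1, - 1}. J - M14_graph s J \<in> M14_free)" (is "_ \<longleftrightarrow> ?nf")
proof
  assume ?nf
  then have "aut_equivalent M14_bracket (M14_J (sgn (J $ 3 $ 6))) J"
    and "M14_J (sgn (J $ 3 $ 6)) \<in> complex_structures M14_bracket"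
    using M14_normal_form_equivalent[THEN aut_equivalent_sym, of J]
      M14_J_complex_structure[of "sgn (J $ 3 $ 6)"]
    by (blast, simp add: sgn_if)
  then show "J \<in> complex_structures M14_bracket" by (rule aut_equivalent_complex_structure)
qed (use M14_complex_structure_normal_form in blast)

lemma M14_complex_structure_equivalent:
  assumes "J \<in> complex_structures M14_bracket"
  shows "aut_equivalent M14_bracket J (M14_J 1) \<or> aut_equivalent M14_bracket J (M14_J (- 1))"
proof -
  obtain s where "J $ 3 $ 6 \<noteq> 0" "s \<in> {1, - 1}" "J - M14_graph s J \<in> M14_free"
    using assms M14_complex_structure_iff by blast
  then show ?thesis using M14_normal_form_equivalent[of J s]
    by (cases "J $ 3 $ 6 > 0") (simp_all add: sgn_if)
qed

text \<open>An intertwining automorphism maps the center to itself, and its block on \<open>x\<^sub>1, x\<^sub>2\<close> rescales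
  \<open>x\<^sub>6\<close> relative to \<open>x\<^sub>3\<close> by a sum of two squares, whereas changing the sign of \<open>\<epsilon>\<close> would need a
  negative factor.\<close>

lemma M14_J_not_equivalent: "\<not> aut_equivalent M14_bracket (M14_J 1) (M14_J (- 1))"
proof
  assume "aut_equivalent M14_bracket (M14_J 1) (M14_J (- 1))"
  then obtain \<Phi> where \<Phi>: "\<Phi> \<in> lie_automorphisms M14_bracket"
    and eq: "M14_J 1 ** \<Phi> = \<Phi> ** M14_J (- 1)"
    unfolding aut_equivalent_iff by blast
  have br: "\<Phi> *v M14_bracket X Y = M14_bracket (\<Phi> *v X) (\<Phi> *v Y)" for X Y
    using \<Phi> by (simp add: lie_automorphisms_def)
  have "M14_bracket (x_basis 1) (x_basis 3) = x_basis 4"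
    "M14_bracket (x_basis 1) (x_basis 4) = x_basis 6"
    by (simp_all add: M14_bracket_basis M14_table_def)
  then have c4: "\<Phi> *v x_basis 4 = M14_bracket (\<Phi> *v x_basis 1) (\<Phi> *v x_basis 3)"
    and c6: "\<Phi> *v x_basis 6 = M14_bracket (\<Phi> *v x_basis 1) (\<Phi> *v x_basis 4)"
    by (simp_all flip: br)
  note c4 = c4[unfolded vec_eq_iff forall_6 M14_bracket_nth matrix_vector_mul_basis_nth]
  have c6': "\<Phi> $ 1 $ 6 = 0" "\<Phi> $ 2 $ 6 = 0" "\<Phi> $ 3 $ 6 = 0" "\<Phi> $ 4 $ 6 = 0" "\<Phi> $ 5 $ 6 = 0"
    and \<Phi>66: "\<Phi> $ 6 $ 6 = \<Phi> $ 1 $ 1 * \<Phi> $ 4 $ 4 + \<Phi> $ 2 $ 1 * \<Phi> $ 5 $ 4"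
    using c6[unfolded vec_eq_iff forall_6 M14_bracket_nth matrix_vector_mul_basis_nth] c4
    by simp_all
  \<comment> \<open>Column 6 compares J(1) \<Phi> x6, a multiple of x3, with -\<Phi> x3. Rows 1 to 3
    tie the scaling of x3 to that of x6 with a minus sign.\<close>
  have "(M14_J 1 ** \<Phi>) $ i $ j = (\<Phi> ** M14_J (- 1)) $ i $ j" for i j by (simp add: eq)
  note this[unfolded matrix_matrix_mult_def vec_lambda_beta sum_6 M14_J_def]
  from this[of 3 6] this[of 1 6] this[of 2 6]
  have "\<Phi> $ 6 $ 6 = - \<Phi> $ 3 $ 3" "\<Phi> $ 1 $ 3 = 0" "\<Phi> $ 2 $ 3 = 0"
    by (simp_all add: vector_6 c6')
  then have "\<Phi> $ 6 $ 6 = - \<Phi> $ 6 $ 6 * (\<Phi> $ 1 $ 1 * \<Phi> $ 1 $ 1 + \<Phi> $ 2 $ 1 * \<Phi> $ 2 $ 1)"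
    using \<Phi>66 c4 by (simp add: algebra_simps)
  then have "\<Phi> $ 6 $ 6 * (1 + (\<Phi> $ 1 $ 1 * \<Phi> $ 1 $ 1 + \<Phi> $ 2 $ 1 * \<Phi> $ 2 $ 1)) = 0"
    by (simp add: algebra_simps)
  moreover have "1 + (\<Phi> $ 1 $ 1 * \<Phi> $ 1 $ 1 + \<Phi> $ 2 $ 1 * \<Phi> $ 2 $ 1) > 0"
    by (intro add_pos_nonneg add_nonneg_nonneg) simp_all
  ultimately have "\<Phi> $ 6 $ 6 = 0" by simp
  then have "\<Phi> *v x_basis 6 = 0"
    using c6' by (simp add: vec_eq_iff forall_6 matrix_vector_mul_basis_nth)
  moreover obtain \<Psi> where "\<Psi> ** \<Phi> = mat 1"
    using \<Phi> by (auto simp: lie_automorphisms_def invertible_def)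
  ultimately have "x_basis 6 = (0 :: real ^ 6)"
    by (metis matrix_vector_mul_assoc matrix_vector_mul_lid matrix_vector_mult_0_right)
  then show False by (simp add: axis_eq_0_iff)
qed

section \<open>The submanifold structure\<close>

lemma M14_graph_free: "i \<in> {3, 4, 5, 6} \<Longrightarrow> j \<in> {1, 6} \<Longrightarrow> M14_graph s J $ i $ j = 0"
  unfolding M14_graph_def Let_def M14_dependent_def by (elim insertE emptyE; simp only: vector_6)

lemma M14_graph_21: "M14_graph s J $ 2 $ 1 = s"
  unfolding M14_graph_def Let_def M14_dependent_def vector_6 ..

lemma M14_graph_cong:
  "(\<And>i j. i \<in> {3, 4, 5, 6} \<Longrightarrow> j \<in> {1, 6} \<Longrightarrow> J $ i $ j = K $ i $ j) \<Longrightarrow> M14_graph s J = M14_graph s K"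
  by (simp add: M14_graph_def)

lemma smooth_on_M14_graph:
  assumes "open U" "\<And>J. J \<in> U \<Longrightarrow> J $ 3 $ 6 \<noteq> 0"
  shows "smooth_on U (M14_graph s)"
  unfolding smooth_on_def
proof
  fix k
  have inv: "Ck_on k U (\<lambda>J. inverse (J $ 3 $ 6))"
    by (rule Ck_on_inverse[OF assms(1) Ck_on_matrix_entry[OF assms(1)] assms(2)])
  note Ck_on_intros = inv Ck_on_const Ck_on_matrix_entry[OF assms(1)] Ck_on_add[OF assms(1)]
    Ck_on_diff[OF assms(1)] Ck_on_minus[OF assms(1)] Ck_on_mult[OF assms(1)]
  have "\<forall>i j. Ck_on k U (\<lambda>J. M14_graph s J $ i $ j)"
    unfolding forall_6 M14_graph_def Let_def M14_dependent_def vector_6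
    by (intro conjI Ck_on_intros)
  then show "Ck_on k U (M14_graph s)" by (intro Ck_on_matrix[OF assms(1)]) blast
qed

text \<open>Brings the space into the form of \<open>subspace_substandard\<close> and
  \<open>dim_substandard\<close>, which reduce the dimension to counting eight matrix units.\<close>

lemma M14_free_eq:
  "M14_free = {K. \<forall>b\<in>Basis. b \<notin> (\<lambda>(i, j). axis i (axis j 1)) ` ({3, 4, 5, 6} \<times> {1, 6}) \<longrightarrow> K \<bullet> b = 0}"
    (is "_ = {K. \<forall>b\<in>Basis. b \<notin> ?f ` ?A \<longrightarrow> _ K b}")
proof -
  have "?f p \<in> ?f ` ?A \<longleftrightarrow> p \<in> ?A" for p
    by (rule inj_image_mem_iff) (auto simp: inj_on_def axis_eq_axis)
  then have D: "axis i (axis j 1) \<in> ?f ` ?A \<longleftrightarrow> i \<in> {3, 4, 5, 6} \<and> j \<in> {1, 6}" for i j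
    by (metis case_prod_conv mem_Times_iff fst_conv snd_conv)
  have "(\<forall>b\<in>Basis. P b) \<longleftrightarrow> (\<forall>i j. P (axis i (axis j 1)))" for P :: "real ^ 6 ^ 6 \<Rightarrow> bool"
    by (simp add: Basis_vec_def)
  then show ?thesis
    unfolding M14_free_def by (simp only: D inner_axis inner_real_def mult_1_right de_Morgan_conj) blast
qed

lemma subspace_M14_free: "subspace M14_free"
  unfolding M14_free_eq by (rule subspace_substandard)

lemma dim_M14_free: "dim M14_free = 8"
proof -
  let ?f = "\<lambda>(i, j). axis i (axis j 1) :: real ^ 6 ^ 6"
  have "dim M14_free = card (?f ` ({3, 4, 5, 6} \<times> {1, 6}))"
    unfolding M14_free_eq by (rule dim_substandard) (auto simp: Basis_vec_def)
  also have "\<dots> = card ({3, 4, 5, 6 :: 6} \<times> {1, 6 :: 6})"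
    by (rule card_image) (auto simp: inj_on_def axis_eq_axis)
  finally show ?thesis by (simp add: card_cartesian_product)
qed

text \<open>Each point lies on one of the two graphs s = 1, s = -1. The entry (2,1) equals s there,
  so its sign separates them, and the shear by \<open>M14_graph\<close> flattens one graph onto an
  open part of \<open>M14_free\<close>.\<close>

lemma smooth_submanifold_M14_complex_structures:
  "smooth_submanifold 8 (complex_structures M14_bracket)"
  unfolding smooth_submanifold_def
proof
  fix p assume p: "p \<in> complex_structures M14_bracket"
  then obtain s where s: "s \<in> {1, - 1}" and ps: "p - M14_graph s p \<in> M14_free"
    and p36: "p $ 3 $ 6 \<noteq> 0"
    unfolding M14_complex_structure_iff by blast
  let ?G = "M14_graph s"
  \<comment> \<open>The condition on the entry (2,1) keeps the other graph out of \<open>U\<close>.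
    The shear subtracts s from that entry, hence s^2 = 1 from the product, which turns the bound 0
    into -1 for \<open>V\<close>.\<close>
  define U where "U = {J :: real ^ 6 ^ 6. J $ 3 $ 6 \<noteq> 0 \<and> 0 < s * J $ 2 $ 1}"
  define V where "V = {J :: real ^ 6 ^ 6. J $ 3 $ 6 \<noteq> 0 \<and> - 1 < s * J $ 2 $ 1}"
  have ss: "s * s = 1" using s by auto
  have J21: "J $ 2 $ 1 = s'" if "J - M14_graph s' J \<in> M14_free" for J s'
  proof -
    have "(J - M14_graph s' J) $ 2 $ 1 = 0"
      using that[unfolded M14_free_def mem_Collect_eq, THEN spec, THEN spec, of 2 1] by simp
    then show ?thesis by (simp add: M14_graph_21)
  qed
  have inv: "?G (J - ?G J) = ?G J" "?G (J + ?G J) = ?G J" for J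
    by (rule M14_graph_cong, simp add: M14_graph_free)+
  have UV: "J - ?G J \<in> V" if "J \<in> U" for J
    using that ss by (simp add: U_def V_def M14_graph_free M14_graph_21 right_diff_distrib)
  have VU: "K + ?G K \<in> U" if "K \<in> V" for K
    using that ss by (simp add: U_def V_def M14_graph_free M14_graph_21 distrib_left)
  have cont: "continuous_on UNIV (\<lambda>J :: real ^ 6 ^ 6. J $ i $ j)" for i j
    using Ck_on_matrix_entry[of UNIV 0 i j] by (simp only: open_UNIV Ck_on.simps)
  have o: "open {J :: real ^ 6 ^ 6. J $ 3 $ 6 \<noteq> 0}"
    "open {J :: real ^ 6 ^ 6. c < s * J $ 2 $ 1}" for c
    by (rule open_Collect_neq[OF cont continuous_on_const]
        open_Collect_less[OF continuous_on_const continuous_on_mult_left[OF cont]])+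
  have op: "open U" "open V"
    unfolding U_def V_def by (rule open_Collect_conj[OF o])+
  have "smooth_on U ?G" by (rule smooth_on_M14_graph[OF op(1)]) (simp add: U_def)
  moreover have "smooth_on V ?G" by (rule smooth_on_M14_graph[OF op(2)]) (simp add: V_def)
  ultimately have diffeo: "diffeomorphism U V (\<lambda>J. J - ?G J) (\<lambda>K. K + ?G K)"
    by (rule shear_diffeomorphism[where G = ?G, OF op _ _ UV VU inv])
  have pU: "p \<in> U" using p36 J21[OF ps] ss by (simp add: U_def)
  have image: "(\<lambda>J. J - ?G J) ` (U \<inter> complex_structures M14_bracket) = V \<inter> M14_free"
  proof (intro equalityI subsetI)
    fix K assume "K \<in> (\<lambda>J. J - ?G J) ` (U \<inter> complex_structures M14_bracket)"
    then obtain J where J: "J \<in> U" "J \<in> complex_structures M14_bracket" "K = J - ?G J" by blast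
    then obtain s' where s': "s' \<in> {1, - 1}" "J - M14_graph s' J \<in> M14_free"
      unfolding M14_complex_structure_iff by blast
    have "0 < s * s'" using J(1) J21[OF s'(2)] by (simp add: U_def)
    then have "s' = s" using s s'(1) by auto
    with s'(2) UV[OF J(1)] show "K \<in> V \<inter> M14_free" unfolding J(3) by (simp only: Int_iff simp_thms)
  next
    fix K assume K: "K \<in> V \<inter> M14_free"
    let ?J = "K + ?G K"
    have J: "?J - ?G ?J = K" by (simp only: inv add_diff_cancel)
    have JU: "?J \<in> U" using K VU by blast
    have "?J - ?G ?J \<in> M14_free" unfolding J using K by blast
    moreover have "?J $ 3 $ 6 \<noteq> 0" using JU unfolding U_def by blast
    ultimately have "?J \<in> complex_structures M14_bracket"
      unfolding M14_complex_structure_iff using s by blast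
    with JU have "?J \<in> U \<inter> complex_structures M14_bracket" by (rule IntI)
    then have "(\<lambda>J. J - ?G J) ?J \<in> (\<lambda>J. J - ?G J) ` (U \<inter> complex_structures M14_bracket)"
      by (rule imageI)
    then show "K \<in> (\<lambda>J. J - ?G J) ` (U \<inter> complex_structures M14_bracket)"
      unfolding J .
  qed
  show "\<exists>U (V :: (real ^ 6 ^ 6) set) \<phi> \<psi> T. p \<in> U \<and> diffeomorphism U V \<phi> \<psi> \<and> subspace T \<and>
      dim T = 8 \<and> \<phi> ` (U \<inter> complex_structures M14_bracket) = V \<inter> T"
    using pU diffeo subspace_M14_free dim_M14_free image by blast
qed

theorem mainTheorem9:
  shows "M14_J 1 \<in> complex_structures M14_bracket \<and>
    M14_J (-1) \<in> complex_structures M14_bracket \<and>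
    (\<forall>J\<in>complex_structures M14_bracket.
       aut_equivalent M14_bracket J (M14_J 1) \<or> aut_equivalent M14_bracket J (M14_J (-1))) \<and>
    \<not> aut_equivalent M14_bracket (M14_J 1) (M14_J (-1)) \<and>
    complex_structures M14_bracket
      = aut_orbit M14_bracket (M14_J 1) \<union> aut_orbit M14_bracket (M14_J (-1)) \<and>
    card {aut_orbit M14_bracket J | J. J \<in> complex_structures M14_bracket} = 2 \<and>
    smooth_submanifold 8 (complex_structures M14_bracket)"
proof -
  let ?X = "complex_structures M14_bracket" and ?O = "aut_orbit M14_bracket"
  have J: "M14_J 1 \<in> ?X" "M14_J (- 1) \<in> ?X" by (simp_all add: M14_J_complex_structure)
  have "?X = ?O (M14_J 1) \<union> ?O (M14_J (- 1))"
    using J M14_complex_structure_equivalent aut_equivalent_complex_structure aut_equivalent_sym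
    unfolding aut_orbit_eq by blast
  moreover have "card {?O J | J. J \<in> ?X} = 2"
  proof -
    have "{?O J | J. J \<in> ?X} = {?O (M14_J 1), ?O (M14_J (- 1))}"
      using J M14_complex_structure_equivalent aut_orbit_cong[of M14_bracket] by blast
    \<comment> \<open>J(-1) lies in its own orbit: of the two alternatives for it, equivalence to
      J(1) is excluded. It does not lie in the orbit of J(1).\<close>
    moreover have "?O (M14_J 1) \<noteq> ?O (M14_J (- 1))"
      using M14_complex_structure_equivalent[OF J(2)] M14_J_not_equivalent
        aut_equivalent_sym[of M14_bracket] unfolding aut_orbit_eq by blast
    ultimately show ?thesis by simp
  qed
  ultimately show ?thesis
    using J M14_complex_structure_equivalent M14_J_not_equivalent
      smooth_submanifold_M14_complex_structures
    by blast
qed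

end
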